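(* Let $\mathbf t=(t_0,u_0,t_1,u_1)\in\mathbb C^4$ be generic (in the sense specified in the context), and put $(a,b,c,d)=(t_1+u_1,t_1-u_1,t_0+u_0+\frac12,t_0-u_0+\frac12)$. For $n\in\mathbb Z_{\ge0}$ the renormalized symmetric Wilson polynomials have the explicit expression $$E^+(x,\gamma_{2n})={}_4F_3\left(\begin{matrix}-n,\ n+a+b+c+d-1,\ a+x,\ a-x\\ a+b,\ a+c,\ a+d\end{matrix};1\right).$$
   Context: $\mathbb N=\{1,2,\dots\}$; $\mathcal A=\mathbb C[x]$. Generic means: $t_0,t_1\ne0$; $t_0+t_1\notin-\frac12\mathbb N$; $a,b,c,d\notin-\frac12\mathbb Z_{\ge0}$; no sum of two of $a,b,c,d$ (at distinct positions) lies in $\mathbb Z$. Operators on $\mathcal A$: $$(T_0f)(x)=t_0f(x)+\frac{(c-x)(d-x)}{1-2x}\big(f(1-x)-f(x)\big),\quad (T_1f)(x)=t_1f(x)+\frac{(a+x)(b+x)}{2x}\big(f(-x)-f(x)\big),$$ $Y=T_0+T_1$, $C_+=\frac1{2t_1}(t_1+T_1)$. With $\gamma_{2n}=t_0+t_1+n$ ($n\ge0$), $\gamma_{2n-1}=-(t_0+t_1+n)$ ($n\ge1$), $p_m$ is the unique monic polynomial of degree $m$ with $Yp_m=\gamma_mp_m$; $x_0=t_1+u_1=a$; $E(x,\gamma_m)=p_m(x)/p_m(-x_0)$; and $E^+(\cdot,\gamma_{m})=C_+E(\cdot,\gamma_{m})$. Equivalently $E^+(x,\gamma_{2n})=P_{2n}^+(x)/P_{2n}^+(x_0)$,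 where $P_{2n}^+$ is the unique monic even polynomial in $\mathrm{span}\{p_{2n},p_{2n-1}\}$ (for $n=0$, in $\mathrm{span}\{p_0\}$). ${}_4F_3\left(\begin{matrix}\alpha_1,\dots,\alpha_4\\ \beta_1,\beta_2,\beta_3\end{matrix};y\right)=\sum_{j\ge0}\frac{(\alpha_1)_j\cdots(\alpha_4)_j}{(\beta_1)_j(\beta_2)_j(\beta_3)_j}\frac{y^j}{j!}$ with $(\alpha)_0=1$, $(\alpha)_j=\alpha(\alpha+1)\cdots(\alpha+j-1)$. *)

theory Defs
  imports Complex_Main "HOL-Computational_Algebra.Polynomial"
begin

text \<open>
  Throughout, the parameters are \<open>(t0, u0, t1, u1)\<close>, and
  \<open>a = t1 + u1\<close>, \<open>b = t1 - u1\<close>, \<open>c = t0 + u0 + 1/2\<close>, \<open>d = t0 - u0 + 1/2\<close>.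
\<close>

definition generic :: "complex \<Rightarrow> complex \<Rightarrow> complex \<Rightarrow> complex \<Rightarrow> bool" where
  "generic t0 u0 t1 u1 \<longleftrightarrow>
    (let a = t1 + u1; b = t1 - u1; c = t0 + u0 + 1/2; d = t0 - u0 + 1/2 in
      t0 \<noteq> 0 \<and> t1 \<noteq> 0 \<and>
      (\<forall>n::nat. n \<ge> 1 \<longrightarrow> t0 + t1 \<noteq> - (of_nat n / 2)) \<and>
      (\<forall>z\<in>{a, b, c, d}. \<forall>n::nat. z \<noteq> - (of_nat n / 2)) \<and>
      a + b \<notin> \<int> \<and> a + c \<notin> \<int> \<and> a + d \<notin> \<int> \<and>
      b + c \<notin> \<int> \<and> b + d \<notin> \<int> \<and> c + d \<notin> \<int>)"

text \<open>
  The operators act on polynomials. The divided differences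
  \<open>(f(1-x) - f(x)) / (1-2x)\<close> and \<open>(f(-x) - f(x)) / (2x)\<close> are polynomials, so the
  polynomial division below is exact; see \<open>poly_T0\<close> and \<open>poly_T1\<close>.
\<close>

definition T0 :: "complex \<Rightarrow> complex \<Rightarrow> complex poly \<Rightarrow> complex poly" where
  "T0 t0 u0 f =
    (let c = t0 + u0 + 1/2; d = t0 - u0 + 1/2 in
      smult t0 f + [:c, -1:] * [:d, -1:] * ((f \<circ>\<^sub>p [:1, -1:] - f) div [:1, -2:]))"

definition T1 :: "complex \<Rightarrow> complex \<Rightarrow> complex poly \<Rightarrow> complex poly" where
  "T1 t1 u1 f =
    (let a = t1 + u1; b = t1 - u1 in
      smult t1 f + [:a, 1:] * [:b, 1:] * ((f \<circ>\<^sub>p [:0, -1:] - f) div [:0, 2:]))"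

lemma poly_T0:
  assumes "x \<noteq> 1/2"
  shows "poly (T0 t0 u0 f) x = t0 * poly f x +
    (t0 + u0 + 1/2 - x) * (t0 - u0 + 1/2 - x) / (1 - 2 * x) * (poly f (1 - x) - poly f x)"
proof -
  define g where "g = f \<circ>\<^sub>p [:1, -1:] - f"
  have "poly g (1/2) = 0"
    by (simp add: g_def poly_pcompose)
  then have "[:-(1/2), 1:] dvd g"
    by (simp add: poly_eq_0_iff_dvd)
  then have "smult (-2) [:-(1/2), 1:] dvd g"
    by (subst smult_dvd_iff) simp
  then have "[:1, -2:] dvd g"
    by simp
  then have "g = [:1, -2:] * (g div [:1, -2:])"
    by (metis dvd_mult_div_cancel)
  then have "poly g x = poly ([:1, -2:] * (g div [:1, -2:])) x"
    by (rule arg_cong)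
  then have "poly g x = (1 - 2 * x) * poly (g div [:1, -2:]) x"
    by (simp only: poly_mult) (simp add: mult.commute)
  moreover have "1 - 2 * x \<noteq> 0"
    using assms by (auto simp: field_simps)
  ultimately have *: "poly (g div [:1, -2:]) x = poly g x / (1 - 2 * x)"
    by simp
  have "poly [:z, -1:] x = z - x" for z :: complex
    by simp
  moreover have "poly g x = poly f (1 - x) - poly f x"
    by (simp add: g_def poly_pcompose)
  ultimately show ?thesis
    using *
    by (simp only: T0_def Let_def g_def[symmetric] poly_add poly_mult poly_smult) simp
qed

lemma poly_T1:
  assumes "x \<noteq> 0"
  shows "poly (T1 t1 u1 f) x = t1 * poly f x +
    (t1 + u1 + x) * (t1 - u1 + x) / (2 * x) * (poly f (- x) - poly f x)"
proof -
  define g where "g = f \<circ>\<^sub>p [:0, -1:] - f"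
  have "poly g 0 = 0"
    by (simp add: g_def poly_pcompose)
  then have "[:0, 1:] dvd g"
    by (simp add: poly_eq_0_iff_dvd)
  then have "smult 2 [:0, 1:] dvd g"
    by (subst smult_dvd_iff) simp
  then have "[:0, 2:] dvd g"
    by simp
  then have "g = [:0, 2:] * (g div [:0, 2:])"
    by (metis dvd_mult_div_cancel)
  then have "poly g x = poly ([:0, 2:] * (g div [:0, 2:])) x"
    by (rule arg_cong)
  then have "poly g x = 2 * x * poly (g div [:0, 2:]) x"
    by (simp only: poly_mult) (simp add: mult.commute)
  then have *: "poly (g div [:0, 2:]) x = poly g x / (2 * x)"
    using assms by simp
  have "poly [:z, 1:] x = z + x" for z :: complex
    by simp
  moreover have "poly g x = poly f (- x) - poly f x"
    by (simp add: g_def poly_pcompose)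
  ultimately show ?thesis
    using *
    by (simp only: T1_def Let_def g_def[symmetric] poly_add poly_mult poly_smult) simp
qed

definition Y :: "complex \<Rightarrow> complex \<Rightarrow> complex \<Rightarrow> complex \<Rightarrow> complex poly \<Rightarrow> complex poly" where
  "Y t0 u0 t1 u1 f = T0 t0 u0 f + T1 t1 u1 f"

definition C_plus :: "complex \<Rightarrow> complex \<Rightarrow> complex poly \<Rightarrow> complex poly" where
  "C_plus t1 u1 f = smult (1 / (2 * t1)) (smult t1 f + T1 t1 u1 f)"

definition spec :: "complex \<Rightarrow> complex \<Rightarrow> nat \<Rightarrow> complex" where
  "spec t0 t1 m =
    (if even m then t0 + t1 + of_nat (m div 2) else - (t0 + t1 + of_nat ((m + 1) div 2)))"

lemma spec_even: "spec t0 t1 (2 * n) = t0 + t1 + of_nat n"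
  by (simp add: spec_def)

lemma spec_odd: "n \<ge> 1 \<Longrightarrow> spec t0 t1 (2 * n - 1) = - (t0 + t1 + of_nat n)"
  by (simp add: spec_def)

definition nonsym_wilson :: "complex \<Rightarrow> complex \<Rightarrow> complex \<Rightarrow> complex \<Rightarrow> nat \<Rightarrow> complex poly" where
  "nonsym_wilson t0 u0 t1 u1 m =
    (THE p. degree p = m \<and> lead_coeff p = 1 \<and>
       Y t0 u0 t1 u1 p = smult (spec t0 t1 m) p)"

lemma inj_spec:
  assumes "generic t0 u0 t1 u1"
  shows "inj (spec t0 t1)"
proof (rule injI)
  fix m n assume eq: "spec t0 t1 m = spec t0 t1 n"
  have *: "t0 + t1 + of_nat k \<noteq> - (t0 + t1 + of_nat l)" if "l \<ge> 1" for k l :: nat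
  proof
    assume "t0 + t1 + of_nat k = - (t0 + t1 + of_nat l)"
    then have "2 * (t0 + t1) = - of_nat (k + l)"
      by (simp add: algebra_simps eq_neg_iff_add_eq_0)
    then have "t0 + t1 = - (of_nat (k + l) / 2)"
      by (simp add: field_simps)
    with assms that show False
      unfolding generic_def Let_def by (metis le_add2 le_trans)
  qed
  show "m = n"
  proof (cases "even m \<longleftrightarrow> even n")
    case True
    with eq show ?thesis
      by (cases "even m") (auto simp: spec_def elim!: evenE oddE)
  next
    case False
    then show ?thesis
      using eq *[of "(n + 1) div 2" "m div 2"] *[of "(m + 1) div 2" "n div 2"]
      by (cases "even m") (auto simp: spec_def elim!: evenE oddE)
  qed
qed

text \<open>
  \<open>E(x, \<gamma>\<^sub>m)\<close> and \<open>E\<^sup>+(x, \<gamma>\<^sub>m)\<close>, indexed by \<open>m\<close> instead of the spectral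
  value \<open>\<gamma>\<^sub>m\<close>; by \<open>inj_spec\<close> this is the same for generic parameters.
  The normalization point is \<open>-x\<^sub>0\<close> with \<open>x\<^sub>0 = t1 + u1\<close>.
\<close>

definition E :: "complex \<Rightarrow> complex \<Rightarrow> complex \<Rightarrow> complex \<Rightarrow> nat \<Rightarrow> complex poly" where
  "E t0 u0 t1 u1 m =
    smult (1 / poly (nonsym_wilson t0 u0 t1 u1 m) (- (t1 + u1))) (nonsym_wilson t0 u0 t1 u1 m)"

definition E_plus :: "complex \<Rightarrow> complex \<Rightarrow> complex \<Rightarrow> complex \<Rightarrow> nat \<Rightarrow> complex poly" where
  "E_plus t0 u0 t1 u1 m = C_plus t1 u1 (E t0 u0 t1 u1 m)"

definition hypergeo_4F3 ::
  "complex \<Rightarrow> complex \<Rightarrow> complex \<Rightarrow> complex \<Rightarrow> complex \<Rightarrow> complex \<Rightarrow> complex \<Rightarrow> complex \<Rightarrow> complex" where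
  "hypergeo_4F3 \<alpha>1 \<alpha>2 \<alpha>3 \<alpha>4 \<beta>1 \<beta>2 \<beta>3 y =
    (\<Sum>j. pochhammer \<alpha>1 j * pochhammer \<alpha>2 j * pochhammer \<alpha>3 j * pochhammer \<alpha>4 j /
      (pochhammer \<beta>1 j * pochhammer \<beta>2 j * pochhammer \<beta>3 j) * (y ^ j / fact j))"

end

theory Submission
  imports Defs
begin

text \<open>
  Both \<open>T\<^sub>0\<close> and \<open>T\<^sub>1\<close> square to scalars, so on even polynomials (where \<open>T\<^sub>1 = t\<^sub>1\<close>) one has
  \<open>Y\<^sup>2 = t\<^sub>0\<^sup>2 + t\<^sub>1\<^sup>2 + (T\<^sub>1 + t\<^sub>1) T\<^sub>0\<close>, and \<open>(T\<^sub>1 + t\<^sub>1) T\<^sub>0\<close> is Wilson's second order difference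
  operator up to a constant. It is bidiagonal in the basis \<open>(a + x)\<^sub>j (a - x)\<^sub>j\<close>, and the
  \<open>\<^sub>4F\<^sub>3\<close> series \<open>W\<close> is its eigenfunction, whence \<open>Y\<^sup>2 W = \<gamma>\<^sup>2 W\<close> for \<open>\<gamma> = \<gamma>\<^sub>2\<^sub>n\<close>. Therefore
  \<open>(Y + \<gamma>) W\<close> is an eigenvector of \<open>Y\<close>. As \<open>Y\<close> is triangular with distinct eigenvalues, it is a
  multiple of \<open>p\<^sub>2\<^sub>n\<close> (for \<open>n > 0\<close>), and its image under \<open>C\<^sub>+\<close> is a nonzero multiple of \<open>W\<close>. The multiple
  is fixed by evaluation at \<open>-a\<close>, since \<open>C\<^sub>+\<close> preserves the value there.
\<close>

section \<open>Basic algebra of the operators\<close>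

lemma poly_eqI_cofinite:
  fixes p q :: "complex poly"
  assumes "finite S" and "\<And>x. x \<notin> S \<Longrightarrow> poly p x = poly q x"
  shows "p = q"
proof (rule ccontr)
  assume "p \<noteq> q"
  then have "finite {x. poly (p - q) x = 0}"
    by (intro poly_roots_finite) simp
  moreover have "- S \<subseteq> {x. poly (p - q) x = 0}"
    using assms(2) by auto
  ultimately have "finite (- S)"
    by (rule rev_finite_subset)
  with assms(1) show False
    using finite_Un[of S "- S"] infinite_UNIV_char_0[where 'a = complex] by (simp add: Compl_partition)
qed

text \<open>The points 0 and 1/2 are fixed by \<open>x -> -x\<close> and \<open>x -> 1 - x\<close>;
  the pointwise formulas for \<open>T1\<close> and \<open>T0\<close> hold away from them.\<close>

lemmas poly_eqI_off_fixed_points = poly_eqI_cofinite[of "{0, 1/2}"]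

text \<open>The factor \<open>k\<close> is chosen before \<open>f\<close>. That is all linearity
  needs, and it keeps the rational function away from the simplifier.\<close>

lemma T0_pointwise:
  assumes "x \<noteq> 1/2"
  obtains k where
    "\<And>f. poly (T0 t0 u0 f) x = t0 * poly f x + k * (poly f (1 - x) - poly f x)"
  using assms that by (blast intro: poly_T0)

lemma T1_pointwise:
  assumes "x \<noteq> 0"
  obtains k where
    "\<And>f. poly (T1 t1 u1 f) x = t1 * poly f x + k * (poly f (- x) - poly f x)"
  using assms that by (blast intro: poly_T1)

lemma T0_add: "T0 t0 u0 (f + g) = T0 t0 u0 f + T0 t0 u0 g"
proof (rule poly_eqI_off_fixed_points)
  fix x :: complex assume "x \<notin> {0, 1/2}"
  then obtain k where *:
    "\<And>f. poly (T0 t0 u0 f) x = t0 * poly f x + k * (poly f (1 - x) - poly f x)"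
    using T0_pointwise by blast
  show "poly (T0 t0 u0 (f + g)) x = poly (T0 t0 u0 f + T0 t0 u0 g) x"
    by (simp add: * algebra_simps)
qed simp

lemma T0_smult: "T0 t0 u0 (smult r f) = smult r (T0 t0 u0 f)"
proof (rule poly_eqI_off_fixed_points)
  fix x :: complex assume "x \<notin> {0, 1/2}"
  then obtain k where *:
    "\<And>f. poly (T0 t0 u0 f) x = t0 * poly f x + k * (poly f (1 - x) - poly f x)"
    using T0_pointwise by blast
  show "poly (T0 t0 u0 (smult r f)) x = poly (smult r (T0 t0 u0 f)) x"
    by (simp add: * algebra_simps)
qed simp

lemma T1_add: "T1 t1 u1 (f + g) = T1 t1 u1 f + T1 t1 u1 g"
proof (rule poly_eqI_off_fixed_points)
  fix x :: complex assume "x \<notin> {0, 1/2}"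
  then obtain k where *:
    "\<And>f. poly (T1 t1 u1 f) x = t1 * poly f x + k * (poly f (- x) - poly f x)"
    using T1_pointwise by blast
  show "poly (T1 t1 u1 (f + g)) x = poly (T1 t1 u1 f + T1 t1 u1 g) x"
    by (simp add: * algebra_simps)
qed simp

lemma T1_smult: "T1 t1 u1 (smult r f) = smult r (T1 t1 u1 f)"
proof (rule poly_eqI_off_fixed_points)
  fix x :: complex assume "x \<notin> {0, 1/2}"
  then obtain k where *:
    "\<And>f. poly (T1 t1 u1 f) x = t1 * poly f x + k * (poly f (- x) - poly f x)"
    using T1_pointwise by blast
  show "poly (T1 t1 u1 (smult r f)) x = poly (smult r (T1 t1 u1 f)) x"
    by (simp add: * algebra_simps)
qed simp

lemma Y_add: "Y t0 u0 t1 u1 (f + g) = Y t0 u0 t1 u1 f + Y t0 u0 t1 u1 g"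
  by (simp add: Y_def T0_add T1_add)

lemma Y_smult: "Y t0 u0 t1 u1 (smult k f) = smult k (Y t0 u0 t1 u1 f)"
  by (simp add: Y_def T0_smult T1_smult smult_add_right)

lemma C_plus_add: "C_plus t1 u1 (f + g) = C_plus t1 u1 f + C_plus t1 u1 g"
  by (simp add: C_plus_def T1_add smult_add_right)

lemma C_plus_smult: "C_plus t1 u1 (smult k f) = smult k (C_plus t1 u1 f)"
  by (simp add: C_plus_def T1_smult smult_add_right mult.commute)

text \<open>Writing \<open>T0\<close> as \<open>t0 + \<phi> (s - 1)\<close> with \<open>s\<close>
  the reflection \<open>x -> 1 - x\<close>, the claim reduces to
  \<open>\<phi> x + \<phi> (1 - x) = 2 * t0\<close>, which comes from
  \<open>c + d - 1 = 2 * t0\<close>.\<close>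

lemma T0_T0: "T0 t0 u0 (T0 t0 u0 f) = smult (t0\<^sup>2) f"
proof (rule poly_eqI_off_fixed_points)
  fix x :: complex assume x: "x \<notin> {0, 1/2}"
  define \<phi> where "\<phi> z = (t0 + u0 + 1/2 - z) * (t0 - u0 + 1/2 - z) / (1 - 2 * z)" for z
  have *: "poly (T0 t0 u0 h) z = t0 * poly h z + \<phi> z * (poly h (1 - z) - poly h z)"
    if "z \<noteq> 1/2" for h z
    using that by (simp add: poly_T0 \<phi>_def)
  have x': "x \<noteq> 1/2" "1 - x \<noteq> 1/2" "1 - 2 * x \<noteq> 0"
    using x by (auto simp: field_simps)
  define D where "D = 1 - 2 * x"
  have num: "(t0 + u0 + 1/2 - (1 - x)) * (t0 - u0 + 1/2 - (1 - x)) =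
      (t0 + u0 + 1/2 - x) * (t0 - u0 + 1/2 - x) - 2 * t0 * D"
    by (simp add: D_def field_simps)
  have den: "1 - 2 * (1 - x) = - D" by (simp add: D_def)
  have sym: "\<phi> (1 - x) = 2 * t0 - \<phi> x"
    using x'(3) unfolding \<phi>_def num den D_def[symmetric]
    by (simp add: diff_divide_distrib)
  show "poly (T0 t0 u0 (T0 t0 u0 f)) x = poly (smult (t0\<^sup>2) f) x"
    using x' by (simp add: * sym) algebra
qed simp

lemma T1_even:
  assumes "\<And>x. poly f (- x) = poly f x"
  shows "T1 t1 u1 f = smult t1 f"
  by (rule poly_eqI_off_fixed_points) (simp_all add: poly_T1 assms)

text \<open>The coefficient \<open>(a + x) (b + x) / (2 x)\<close> of \<open>T1\<close> vanishes at
  \<open>x = -a\<close>, so \<open>T1\<close> acts there as the scalar \<open>t1\<close>.\<close>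

lemma poly_C_plus_fixed:
  assumes "t1 \<noteq> 0" and "t1 + u1 \<noteq> 0"
  shows "poly (C_plus t1 u1 f) (- (t1 + u1)) = poly f (- (t1 + u1))"
proof -
  have "- (t1 + u1) \<noteq> 0" using assms(2) by (metis neg_equal_0_iff_equal)
  then have "poly (T1 t1 u1 f) (- (t1 + u1)) = t1 * poly f (- (t1 + u1))"
    by (subst poly_T1) simp_all
  then show ?thesis
    using assms(1) unfolding C_plus_def by (simp add: field_simps)
qed

section \<open>Pochhammer products and leading coefficients\<close>

definition poch_prod :: "complex \<Rightarrow> complex \<Rightarrow> nat \<Rightarrow> complex poly" where
  "poch_prod \<alpha> \<beta> j = (\<Prod>i<j. [:\<alpha> + of_nat i, 1:] * [:\<beta> + of_nat i, -1:])"

lemma poch_prod_0: "poch_prod \<alpha> \<beta> 0 = 1"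
  by (simp add: poch_prod_def)

lemma poly_poch_prod: "poly (poch_prod \<alpha> \<beta> j) x = pochhammer (\<alpha> + x) j * pochhammer (\<beta> - x) j"
  by (induction j) (simp_all add: poch_prod_def pochhammer_Suc algebra_simps)

text \<open>\<open>top_coeff m p v\<close> allows \<open>v = 0\<close>, so it bounds the degree without fixing it.\<close>

definition top_coeff :: "nat \<Rightarrow> complex poly \<Rightarrow> complex \<Rightarrow> bool" where
  "top_coeff m p v \<longleftrightarrow> degree p \<le> m \<and> coeff p m = v"

lemma top_coeff_add: "top_coeff m p v \<Longrightarrow> top_coeff m q w \<Longrightarrow> top_coeff m (p + q) (v + w)"
  by (auto simp: top_coeff_def degree_add_le)

lemma top_coeff_smult: "top_coeff m p v \<Longrightarrow> top_coeff m (smult k p) (k * v)"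
  by (auto simp: top_coeff_def intro: order_trans[OF degree_smult_le])

lemma top_coeff_mult:
  assumes "top_coeff m p v" and "top_coeff n q w"
  shows "top_coeff (m + n) (p * q) (v * w)"
proof -
  have "degree (p * q) \<le> m + n"
    using assms degree_mult_le[of p q] by (auto simp: top_coeff_def)
  moreover have "coeff (p * q) (m + n) = (\<Sum>i\<le>m + n. if i = m then v * w else 0)"
    unfolding coeff_mult
  proof (rule sum.cong)
    fix i assume "i \<in> {..m + n}"
    consider "i = m" | "i < m" | "i > m" by linarith
    then show "coeff p i * coeff q (m + n - i) = (if i = m then v * w else 0)"
    proof cases
      case 2
      then have "coeff q (m + n - i) = 0"
        using assms(2) by (intro coeff_eq_0) (auto simp: top_coeff_def)
      with 2 show ?thesis by simp
    next
      case 3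
      then have "coeff p i = 0"
        using assms(1) by (intro coeff_eq_0) (auto simp: top_coeff_def)
      with 3 show ?thesis by simp
    qed (use assms in \<open>auto simp: top_coeff_def\<close>)
  qed simp
  ultimately show ?thesis
    by (simp add: top_coeff_def)
qed

lemma top_coeff_linear: "top_coeff 1 [:u, v:] v"
  by (simp add: top_coeff_def)

lemma top_coeff_poch_prod: "top_coeff (2 * j) (poch_prod \<alpha> \<beta> j) ((-1) ^ j)"
proof (induction j)
  case 0
  show ?case by (simp add: top_coeff_def poch_prod_0)
next
  case (Suc j)
  have "top_coeff (2 * j + (1 + 1))
      (poch_prod \<alpha> \<beta> j * ([:\<alpha> + of_nat j, 1:] * [:\<beta> + of_nat j, -1:])) ((-1) ^ j * (1 * -1))"
    by (intro top_coeff_mult Suc.IH top_coeff_linear)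
  then show ?case
    by (simp add: poch_prod_def)
qed

lemma degree_eq_if_top_coeff:
  "top_coeff m p v \<Longrightarrow> v \<noteq> 0 \<Longrightarrow> degree p = m \<and> lead_coeff p = v"
  using le_degree[of p m] by (auto simp: top_coeff_def)

section \<open>Action of the operators on the symmetric basis\<close>

locale wilson_parameters =
  fixes t0 u0 t1 u1 a b c d :: complex
  assumes a_eq: "a = t1 + u1" and b_eq: "b = t1 - u1"
    and c_eq: "c = t0 + u0 + 1/2" and d_eq: "d = t0 - u0 + 1/2"
begin

abbreviation basis :: "nat \<Rightarrow> complex poly" where
  "basis \<equiv> poch_prod a a"

lemma poly_basis_minus: "poly (basis j) (- x) = poly (basis j) x"
  by (simp add: poly_poch_prod)

lemma poly_T0_params:
  assumes "x \<noteq> 1/2"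
  shows "poly (T0 t0 u0 f) x =
    t0 * poly f x + (c - x) * (d - x) / (1 - 2 * x) * (poly f (1 - x) - poly f x)"
  using assms by (simp add: poly_T0 c_eq d_eq)

text \<open>\<open>basis j\<close> and its reflection share all but two linear factors each; the
  products of these differ by \<open>- j (1 - 2 x)\<close>, which cancels the denominator. The
  shared part is why \<open>poch_prod\<close> carries two parameters. For \<open>j = 0\<close> the
  truncated \<open>j - 1\<close> is harmless, as the coefficient is 0.\<close>

lemma T0_basis:
  "T0 t0 u0 (basis j) = smult t0 (basis j) +
    smult (- of_nat j) ([:c, -1:] * [:d, -1:] * poch_prod a (a + 1) (j - 1))"
proof (cases j)
  case 0
  then show ?thesis
    by (intro poly_eqI_off_fixed_points) (simp_all add: poly_T0 poch_prod_0)
next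
  case (Suc k)
  show ?thesis
  proof (rule poly_eqI_off_fixed_points)
    fix x :: complex assume x: "x \<notin> {0, 1/2}"
    then have nz: "1 - 2 * x \<noteq> 0" by (auto simp: field_simps)
    define R where "R = pochhammer (a + x) k * pochhammer (a + 1 - x) k"
    have shift: "a - (1 - x) + 1 = a + x" "a + (1 - x) = a + 1 - x" "a - x + 1 = a + 1 - x"
      by simp_all
    have 1: "poly (basis j) (1 - x) = (a + x - 1) * (a + 1 - x + of_nat k) * R"
      unfolding poly_poch_prod Suc R_def pochhammer_rec[of "a - (1 - x)"]
        pochhammer_Suc[of "a + 1 - x"] shift
      by (simp add: algebra_simps)
    have 2: "poly (basis j) x = (a - x) * (a + x + of_nat k) * R"
      unfolding poly_poch_prod Suc R_def pochhammer_Suc[of "a + x"] pochhammer_rec[of "a - x"] shift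
      by (simp add: algebra_simps)
    have 3: "poly (basis j) (1 - x) - poly (basis j) x = - (of_nat j * R) * (1 - 2 * x)"
      unfolding 1 2 by (simp add: Suc algebra_simps)
    have "poly (T0 t0 u0 (basis j)) x = t0 * poly (basis j) x + (c - x) * (d - x) * (- (of_nat j * R))"
      using x nz by (simp add: poly_T0_params 3)
    then show "poly (T0 t0 u0 (basis j)) x = poly (smult t0 (basis j) +
        smult (- of_nat j) ([:c, -1:] * [:d, -1:] * poch_prod a (a + 1) (j - 1))) x"
      by (simp only: poly_add poly_smult poly_mult poly_poch_prod[of a "a + 1"] Suc diff_Suc_1
          R_def[symmetric]) (simp add: algebra_simps)
  qed simp
qed

lemma T1_basis: "T1 t1 u1 (basis j) = smult t1 (basis j)"
  by (rule T1_even) (rule poly_basis_minus)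

text \<open>A twisted Leibniz rule: reflection turns the factor \<open>x\<close> into
  \<open>1 - x\<close>, and the excess \<open>1 - 2 x\<close> cancels the denominator. It gives
  access to odd degrees.\<close>

lemma T0_times_x:
  "T0 t0 u0 ([:0, 1:] * f) = smult t0 ([:0, 1:] * f) + [:1, -1:] * (T0 t0 u0 f + smult (- t0) f)
    + [:c, -1:] * [:d, -1:] * f"
proof (rule poly_eqI_off_fixed_points)
  fix x :: complex assume "x \<notin> {0, 1/2}"
  then have x: "x \<noteq> 1/2" "1 - 2 * x \<noteq> 0" by (auto simp: field_simps)
  define k where "k = (c - x) * (d - x) / (1 - 2 * x)"
  have T0: "poly (T0 t0 u0 h) x = t0 * poly h x + k * (poly h (1 - x) - poly h x)" for h
    using x by (simp add: poly_T0_params k_def)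
  have "k * (1 - 2 * x) = (c - x) * (d - x)"
    using x by (simp add: k_def)
  then show "poly (T0 t0 u0 ([:0, 1:] * f)) x = poly (smult t0 ([:0, 1:] * f)
      + [:1, -1:] * (T0 t0 u0 f + smult (- t0) f) + [:c, -1:] * [:d, -1:] * f) x"
    unfolding poly_add poly_mult poly_smult T0
    by simp algebra
qed simp

lemma T1_times_x:
  assumes "\<And>x. poly f (- x) = poly f x"
  shows "T1 t1 u1 ([:0, 1:] * f) = smult t1 ([:0, 1:] * f) + - ([:a, 1:] * [:b, 1:]) * f"
proof (rule poly_eqI_off_fixed_points)
  fix x :: complex assume "x \<notin> {0, 1/2}"
  then show "poly (T1 t1 u1 ([:0, 1:] * f)) x =
      poly (smult t1 ([:0, 1:] * f) + - ([:a, 1:] * [:b, 1:]) * f) x"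
    unfolding poly_add poly_mult poly_smult poly_minus
    by (simp add: poly_T1 assms a_eq[symmetric] b_eq[symmetric] field_simps)
qed simp

lemma Y_basis:
  "Y t0 u0 t1 u1 (basis j) = smult (t0 + t1) (basis j) +
    smult (- of_nat j) ([:c, -1:] * [:d, -1:] * poch_prod a (a + 1) (j - 1))"
  unfolding Y_def T0_basis T1_basis by (simp only: smult_add_left algebra_simps)

text \<open>The quadratic terms of \<open>(c - x) (d - x)\<close> and \<open>(a + x) (b + x)\<close>
  cancel, leaving a linear factor, so \<open>Y\<close> does not raise the degree.\<close>

lemma Y_times_x_basis:
  "Y t0 u0 t1 u1 ([:0, 1:] * basis j) = smult (t0 + t1) ([:0, 1:] * basis j) +
    [:c * d - a * b, - (a + b + c + d):] * basis j +
    smult (- of_nat j) ([:1, -1:] * ([:c, -1:] * [:d, -1:] * poch_prod a (a + 1) (j - 1)))"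
  unfolding Y_def T0_times_x T0_basis T1_times_x[OF poly_basis_minus]
  by (rule poly_ext) (simp_all add: algebra_simps)

section \<open>Triangularity of \<open>Y\<close> and uniqueness of its eigenpolynomials\<close>

lemma top_coeff_Y_basis:
  "top_coeff (2 * j) (Y t0 u0 t1 u1 (basis j)) (spec t0 t1 (2 * j) * (-1) ^ j)"
proof (cases j)
  case 0
  have "top_coeff 0 (basis 0) 1" by (simp add: top_coeff_def poch_prod_0)
  from top_coeff_smult[OF this, of "t0 + t1"] show ?thesis
    by (simp add: Y_basis 0 spec_def)
next
  case (Suc k)
  have "top_coeff (2 * j) ([:c, -1:] * [:d, -1:] * poch_prod a (a + 1) (j - 1)) ((-1) ^ k)"
    using top_coeff_mult[OF top_coeff_mult[OF top_coeff_linear top_coeff_linear]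
        top_coeff_poch_prod[of k], of c "-1" d "-1" a "a + 1"]
    by (simp add: Suc)
  note top_coeff_add[OF top_coeff_smult[OF top_coeff_poch_prod] top_coeff_smult[OF this],
      of "t0 + t1" a a "- of_nat j"]
  \<comment> \<open>Since \<open>j = k + 1\<close>, the second term is \<open>j * (-1) ^ j\<close>;
    it shifts \<open>t0 + t1\<close> to \<open>t0 + t1 + j\<close>.\<close>
  moreover have "spec t0 t1 (2 * j) * (-1) ^ j = (t0 + t1) * (-1) ^ j + - of_nat j * (-1) ^ k"
    unfolding spec_even by (simp add: Suc algebra_simps)
  ultimately show ?thesis
    by (simp only: Y_basis)
qed

lemma top_coeff_Y_times_x_basis:
  "top_coeff (2 * j + 1) (Y t0 u0 t1 u1 ([:0, 1:] * basis j)) (spec t0 t1 (2 * j + 1) * (-1) ^ j)"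
proof -
  have x: "top_coeff (2 * j + 1) ([:0, 1:] * basis j) ((-1) ^ j)"
    using top_coeff_mult[OF top_coeff_linear top_coeff_poch_prod, of j 0 1 a a] by simp
  have l: "top_coeff (2 * j + 1) ([:c * d - a * b, - (a + b + c + d):] * basis j)
      (- (a + b + c + d) * (-1) ^ j)"
    using top_coeff_mult[OF top_coeff_linear top_coeff_poch_prod,
        of j "c * d - a * b" "- (a + b + c + d)" a a] by simp
  have r: "top_coeff (2 * j + 1) (smult (- of_nat j)
      ([:1, -1:] * ([:c, -1:] * [:d, -1:] * poch_prod a (a + 1) (j - 1)))) (- of_nat j * (-1) ^ j)"
  proof (cases j)
    case 0
    then show ?thesis by (simp add: top_coeff_def)
  next
    case (Suc k)
    have "top_coeff (2 * j + 1)
        ([:1, -1:] * ([:c, -1:] * [:d, -1:] * poch_prod a (a + 1) (j - 1))) ((-1) ^ j)"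
      using top_coeff_mult[OF top_coeff_linear top_coeff_mult[OF top_coeff_mult[OF
            top_coeff_linear top_coeff_linear] top_coeff_poch_prod[of k]],
          of 1 "-1" c "-1" d "-1" a "a + 1"]
      by (simp add: Suc)
    then show ?thesis by (rule top_coeff_smult)
  qed
  \<comment> \<open>Here \<open>a + b + c + d = 2 * (t0 + t1) + 1\<close> flips the sign of
    \<open>t0 + t1\<close> and supplies the extra 1.\<close>
  have "spec t0 t1 (2 * j + 1) * (-1) ^ j =
      (t0 + t1) * (-1) ^ j + - (a + b + c + d) * (-1) ^ j + - of_nat j * (-1) ^ j"
    by (simp add: spec_def a_eq b_eq c_eq d_eq algebra_simps)
  with top_coeff_add[OF top_coeff_add[OF top_coeff_smult[OF x, of "t0 + t1"] l] r] show ?thesis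
    by (simp only: Y_times_x_basis)
qed

text \<open>The witnesses are \<open>basis j\<close> and \<open>x\<close> times
  \<open>basis j\<close>, made monic by the sign \<open>(-1) ^ j\<close>.\<close>

lemma adapted_basis_exists:
  "\<exists>p. top_coeff m p 1 \<and> top_coeff m (Y t0 u0 t1 u1 p) (spec t0 t1 m)"
proof (cases "even m")
  case True
  then obtain j where m: "m = 2 * j" by blast
  have sign: "(-1) ^ j * (v * (-1) ^ j) = v" for v :: complex
    by (cases "even j") simp_all
  show ?thesis
    using top_coeff_smult[OF top_coeff_poch_prod[of j a a], of "(-1) ^ j"]
      top_coeff_smult[OF top_coeff_Y_basis[of j], of "(-1) ^ j"]
    unfolding m by (intro exI[of _ "smult ((-1) ^ j) (basis j)"]) (simp add: Y_smult sign)
next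
  case False
  then obtain j where m: "m = 2 * j + 1" by (rule oddE)
  have sign: "(-1) ^ j * (v * (-1) ^ j) = v" "(-1) ^ j * (-1) ^ j = (1 :: complex)"
    for v :: complex
    by (cases "even j", simp_all)+
  have "top_coeff m ([:0, 1:] * basis j) ((-1) ^ j)"
    using top_coeff_mult[OF top_coeff_linear top_coeff_poch_prod, of j 0 1 a a] m by simp
  then show ?thesis
    using top_coeff_smult[of m "[:0, 1:] * basis j" "(-1) ^ j" "(-1) ^ j"]
      top_coeff_smult[OF top_coeff_Y_times_x_basis[of j], of "(-1) ^ j"]
    by (intro exI[of _ "smult ((-1) ^ j) ([:0, 1:] * basis j)"])
      (simp only: Y_smult sign m)
qed

text \<open>Subtracting a multiple of the monic witness of degree \<open>m\<close> lowers the
  degree, and the induction hypothesis handles the rest.\<close>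

lemma top_coeff_Y:
  assumes "degree f \<le> m"
  shows "top_coeff m (Y t0 u0 t1 u1 f) (spec t0 t1 m * coeff f m)"
  using assms
proof (induction m arbitrary: f rule: less_induct)
  case (less m)
  obtain p where p: "top_coeff m p 1" "top_coeff m (Y t0 u0 t1 u1 p) (spec t0 t1 m)"
    using adapted_basis_exists by blast
  define g where "g = f + smult (- coeff f m) p"
  have g: "top_coeff m g 0"
    using top_coeff_add[OF _ top_coeff_smult[OF p(1)], of f "coeff f m" "- coeff f m"] less.prems
    by (simp add: g_def top_coeff_def)
  have Yg: "top_coeff m (Y t0 u0 t1 u1 g) 0"
  proof (cases "m = 0")
    case True
    with g have "g = 0"
      by (metis top_coeff_def le_zero_eq leading_coeff_0_iff)
    then show ?thesis
      using Y_smult[of t0 u0 t1 u1 0 0] by (simp add: top_coeff_def)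
  next
    case False
    have "degree g \<le> m - 1"
    proof (rule degree_le, intro allI impI)
      fix i assume "m - 1 < i"
      then have "i = m \<or> degree g < i" using g by (auto simp: top_coeff_def)
      then show "coeff g i = 0" using g by (auto simp: top_coeff_def coeff_eq_0)
    qed
    then have "degree (Y t0 u0 t1 u1 g) \<le> m - 1"
      using less.IH[of "m - 1" g] False by (simp add: top_coeff_def)
    with False show ?thesis
      by (simp add: top_coeff_def coeff_eq_0)
  qed
  have "Y t0 u0 t1 u1 f = Y t0 u0 t1 u1 (g + smult (coeff f m) p)"
    by (simp add: g_def)
  then show ?case
    using top_coeff_add[OF Yg top_coeff_smult[OF p(2), of "coeff f m"]]
    by (simp add: Y_add Y_smult mult.commute)
qed

text \<open>By triangularity, a nonzero eigenvector of \<open>Y\<close> has the eigenvalue belonging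
  to its degree. The difference of two monic solutions has no coefficient at \<open>m\<close>, so
  injectivity of \<open>spec\<close> forces it to vanish.\<close>

lemma nonsym_wilson_eqI:
  assumes "generic t0 u0 t1 u1" and "degree p = m" and "lead_coeff p = 1"
    and "Y t0 u0 t1 u1 p = smult (spec t0 t1 m) p"
  shows "nonsym_wilson t0 u0 t1 u1 m = p"
  unfolding nonsym_wilson_def
proof (rule the_equality)
  fix q assume q: "degree q = m \<and> lead_coeff q = 1 \<and>
    Y t0 u0 t1 u1 q = smult (spec t0 t1 m) q"
  define r where "r = q + smult (-1) p"
  have Yr: "Y t0 u0 t1 u1 r = smult (spec t0 t1 m) r"
    using q assms by (simp only: r_def Y_add Y_smult smult_add_right) (simp add: mult.commute)
  have "r = 0"
  proof (rule ccontr)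
    assume "r \<noteq> 0"
    then have "spec t0 t1 m = spec t0 t1 (degree r)"
      using top_coeff_Y[of r "degree r"] by (simp add: top_coeff_def Yr)
    then have "degree r = m"
      using inj_spec[OF assms(1)] by (simp add: inj_eq)
    moreover have "coeff q m = 1" "coeff p m = 1"
      using q assms(2,3) by auto
    then have "coeff r m = 0"
      by (simp add: r_def)
    ultimately show False
      using \<open>r \<noteq> 0\<close> by (metis leading_coeff_0_iff)
  qed
  then show "q = p"
    by (simp add: r_def)
qed (use assms in simp)

section \<open>Wilson's second order difference operator\<close>

definition wilson_op :: "complex poly \<Rightarrow> complex poly" where
  "wilson_op f = smult t1 (T0 t0 u0 f) + T1 t1 u1 (T0 t0 u0 f)"

lemma wilson_op_add: "wilson_op (f + g) = wilson_op f + wilson_op g"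
  by (simp add: wilson_op_def T0_add T1_add smult_add_right)

lemma wilson_op_smult: "wilson_op (smult k f) = smult k (wilson_op f)"
  by (simp add: wilson_op_def T0_smult T1_smult smult_add_right mult.commute)

text \<open>After \<open>basis k\<close> is factored out, \<open>(t1 + T1) h\<close> becomes the odd
  part of \<open>(b + x) (c + x) (d + x) (a + k + x)\<close> divided by \<open>x\<close>, an even
  quadratic. Expanding it in \<open>(a + k)^2 - x^2\<close> and 1 gives the two
  coefficients.\<close>

lemma wilson_op_basis:
  "wilson_op (basis j) = smult (2 * t0 * t1 + of_nat j * (of_nat j + (a + b + c + d - 1))) (basis j)
    + smult (- of_nat j * ((a + b + of_nat (j - 1)) * (a + c + of_nat (j - 1)) *
        (a + d + of_nat (j - 1)))) (basis (j - 1))"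
proof (cases j)
  case 0
  have "T0 t0 u0 (basis j) = smult t0 (basis j)"
    by (simp add: T0_basis 0)
  with 0 show ?thesis
    unfolding wilson_op_def
    by (intro poly_ext) (simp_all add: T1_smult T1_basis algebra_simps)
next
  case (Suc k)
  define h where "h = [:c, -1:] * [:d, -1:] * poch_prod a (a + 1) k"
  have T0: "T0 t0 u0 (basis j) = smult t0 (basis j) + smult (- of_nat j) h"
    using T0_basis[of j] by (simp only: h_def Suc diff_Suc_1)
  have "smult t1 h + T1 t1 u1 h =
    smult (- (of_nat j + (a + b + c + d - 1))) (basis j) +
    smult ((a + b + of_nat k) * (a + c + of_nat k) * (a + d + of_nat k)) (basis k)"
  proof (rule poly_eqI_off_fixed_points)
    fix x :: complex assume "x \<notin> {0, 1/2}"
    then have x: "x \<noteq> 0" by simp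
    define P Q where "P = pochhammer (a + x) k" and "Q = pochhammer (a - x) k"
    \<comment> \<open>With this, \<open>(a + x) (b + x) - 4 t1 x\<close> factors as
      \<open>(a - x) (b - x)\<close>.\<close>
    have t1: "t1 = (a + b) / 2" by (simp add: a_eq b_eq)
    have shift: "z * pochhammer (z + 1) k = pochhammer z k * (z + of_nat k)" for z :: complex
      by (metis pochhammer_rec pochhammer_Suc)
    have "poly h x = (c - x) * (d - x) * (P * pochhammer (a - x + 1) k)"
      by (simp add: h_def poly_poch_prod P_def algebra_simps)
    with shift[of "a - x"]
    have hx: "(a - x) * poly h x = (c - x) * (d - x) * P * (Q * (a - x + of_nat k))"
      unfolding Q_def by algebra
    have "poly h (- x) = (c + x) * (d + x) * (Q * pochhammer (a + x + 1) k)"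
      by (simp add: h_def poly_poch_prod Q_def algebra_simps)
    with shift[of "a + x"]
    have hmx: "(a + x) * poly h (- x) = (c + x) * (d + x) * Q * (P * (a + x + of_nat k))"
      unfolding P_def by algebra
    have "poly (smult t1 h + T1 t1 u1 h) x =
        ((b + x) * ((a + x) * poly h (- x)) - (b - x) * ((a - x) * poly h x)) / (2 * x)"
      using x by (simp add: poly_T1 a_eq[symmetric] b_eq[symmetric])
        (simp add: t1 divide_simps, algebra)
    also have "\<dots> = - (of_nat j + (a + b + c + d - 1)) * (P * (a + x + of_nat k) * (Q * (a - x + of_nat k)))
        + (a + b + of_nat k) * (a + c + of_nat k) * (a + d + of_nat k) * (P * Q)"
      unfolding hx hmx using x by (simp add: Suc divide_simps) algebra
    finally show "poly (smult t1 h + T1 t1 u1 h) x =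
        poly (smult (- (of_nat j + (a + b + c + d - 1))) (basis j) +
          smult ((a + b + of_nat k) * (a + c + of_nat k) * (a + d + of_nat k)) (basis k)) x"
      by (simp only: poly_add[of "smult (- _) _"] poly_smult poly_poch_prod Suc pochhammer_Suc
          P_def Q_def)
  qed simp
  then have *: "T1 t1 u1 h = smult (- (of_nat j + (a + b + c + d - 1))) (basis j) +
    smult ((a + b + of_nat k) * (a + c + of_nat k) * (a + d + of_nat k)) (basis k) - smult t1 h"
    by (simp add: algebra_simps)
  show ?thesis
    unfolding wilson_op_def T0 T1_add T1_smult T1_basis *
    by (rule poly_ext) (simp_all add: Suc algebra_simps)
qed

text \<open>The recurrence makes the lower terms telescope: each partial sum is an eigenvector up to
  a multiple of its last basis element, and that multiple is 0 at \<open>m = n\<close>.\<close>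

lemma wilson_op_eigenvector:
  assumes rec: "\<And>j. w (Suc j) * (of_nat (Suc j) *
      ((a + b + of_nat j) * (a + c + of_nat j) * (a + d + of_nat j))) =
      w j * (of_nat j * (of_nat j + (a + b + c + d - 1)) - of_nat n * (of_nat n + (a + b + c + d - 1)))"
  shows "wilson_op (\<Sum>j\<le>n. smult (w j) (basis j)) =
    smult (2 * t0 * t1 + of_nat n * (of_nat n + (a + b + c + d - 1))) (\<Sum>j\<le>n. smult (w j) (basis j))"
proof -
  let ?ev = "\<lambda>j. of_nat j * (of_nat j + (a + b + c + d - 1))"
  have "wilson_op (\<Sum>j\<le>m. smult (w j) (basis j)) =
      smult (2 * t0 * t1 + ?ev n) (\<Sum>j\<le>m. smult (w j) (basis j)) +
      smult (w m * (?ev m - ?ev n)) (basis m)" for m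
  proof (induction m)
    case 0
    then show ?case
      by (intro poly_ext)
        (simp_all add: wilson_op_smult wilson_op_basis[of 0] algebra_simps)
  next
    case (Suc m)
    have "smult (w (Suc m)) (wilson_op (basis (Suc m))) =
        smult (w (Suc m) * (2 * t0 * t1 + ?ev (Suc m))) (basis (Suc m)) -
        smult (w (Suc m) * (of_nat (Suc m) *
          ((a + b + of_nat m) * (a + c + of_nat m) * (a + d + of_nat m)))) (basis m)"
      unfolding wilson_op_basis[of "Suc m"]
      by (rule poly_ext) (simp_all add: algebra_simps)
    also have "\<dots> = smult (w (Suc m) * (2 * t0 * t1 + ?ev (Suc m))) (basis (Suc m)) -
        smult (w m * (?ev m - ?ev n)) (basis m)"
      by (simp only: rec)
    finally have step: "smult (w (Suc m)) (wilson_op (basis (Suc m))) = \<dots>" .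
    show ?case
      unfolding sum.atMost_Suc wilson_op_add wilson_op_smult Suc.IH step
      by (intro poly_ext) (simp_all add: algebra_simps)
  qed
  from this[of n] show ?thesis by simp
qed

section \<open>From even eigenfunctions to \<open>E_plus\<close>\<close>

lemma Y_Y_even:
  assumes "T1 t1 u1 f = smult t1 f"
  shows "Y t0 u0 t1 u1 (Y t0 u0 t1 u1 f) = smult (t0\<^sup>2 + t1\<^sup>2) f + wilson_op f"
  unfolding Y_def T0_add T1_add T0_T0 assms T0_smult T1_smult wilson_op_def
  by (simp add: smult_add_left power2_eq_square)

lemma C_plus_even:
  assumes "t1 \<noteq> 0" and "T1 t1 u1 f = smult t1 f"
  shows "C_plus t1 u1 f = f"
  using assms by (simp add: C_plus_def smult_add_left[symmetric])

lemma C_plus_Y_even: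
  assumes "t1 \<noteq> 0" and "T1 t1 u1 f = smult t1 f"
  shows "C_plus t1 u1 (Y t0 u0 t1 u1 f) = smult t1 f + smult (1 / (2 * t1)) (wilson_op f)"
proof -
  have "C_plus t1 u1 (T0 t0 u0 f) = smult (1 / (2 * t1)) (wilson_op f)"
    by (simp add: C_plus_def wilson_op_def)
  then show ?thesis
    by (simp add: Y_def C_plus_add assms(2) C_plus_smult C_plus_even[OF assms])
qed

lemma E_plus_eqI:
  assumes gen: "generic t0 u0 t1 u1"
    and deg: "degree f = 2 * n"
    and T1: "T1 t1 u1 f = smult t1 f"
    and eigen: "wilson_op f = smult (2 * t0 * t1 + of_nat n * (of_nat n + (a + b + c + d - 1))) f"
    and norm: "poly f (- a) = 1"
  shows "E_plus t0 u0 t1 u1 (2 * n) = f"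
proof -
  define \<gamma> where "\<gamma> = spec t0 t1 (2 * n)"
  define q where "q = Y t0 u0 t1 u1 f + smult \<gamma> f"
  \<comment> \<open>The scalar by which \<open>C_plus\<close> sends \<open>q\<close> to
    \<open>f\<close>, factored so that genericity can be applied to each factor.\<close>
  define \<kappa> where "\<kappa> = (of_nat n + 2 * (t0 + t1)) * (2 * t1 + of_nat n) / (2 * t1)"
  have t1: "t1 \<noteq> 0" and a: "a \<noteq> 0"
    and t01: "\<And>k::nat. k \<ge> 1 \<Longrightarrow> t0 + t1 \<noteq> - (of_nat k / 2)"
    and ab: "a + b \<notin> \<int>"
    using gen unfolding generic_def Let_def a_eq b_eq by (auto dest: spec[of _ 0])
  have \<gamma>: "\<gamma> = t0 + t1 + of_nat n"
    by (simp add: \<gamma>_def spec_even)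
  have s: "a + b + c + d - 1 = 2 * (t0 + t1)"
    by (simp add: a_eq b_eq c_eq d_eq)
  \<comment> \<open>The scalars add up to a square: \<open>t0^2 + t1^2 + 2 t0 t1 + n (n + 2 (t0 +
    t1)) = (t0 + t1 + n)^2\<close>.\<close>
  have YY: "Y t0 u0 t1 u1 (Y t0 u0 t1 u1 f) = smult (\<gamma>\<^sup>2) f"
    unfolding Y_Y_even[OF T1] eigen s \<gamma> smult_add_left[symmetric]
    by (rule arg_cong[of _ _ "\<lambda>k. smult k f"]) algebra
  show ?thesis
  proof (cases "n = 0")
    case True \<comment> \<open>genericity allows \<open>t0 + t1 = 0\<close>, and then \<open>q = 0\<close>\<close>
    have "f = 1"
      using deg norm True by (auto elim!: degree_eq_zeroE simp: one_pCons)
    moreover have "nonsym_wilson t0 u0 t1 u1 0 = 1"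
      using Y_basis[of 0] by (intro nonsym_wilson_eqI[OF gen]) (simp_all add: spec_def poch_prod_0)
    moreover have "C_plus t1 u1 f = f"
      using t1 T1 by (rule C_plus_even)
    ultimately show ?thesis
      using True by (simp add: E_plus_def E_def flip: one_pCons)
  next
    case False
    have "top_coeff (2 * n) q (2 * \<gamma> * lead_coeff f)"
      using top_coeff_add[OF top_coeff_Y[of f "2 * n"] top_coeff_smult[of "2 * n" f "lead_coeff f" \<gamma>]]
      by (simp add: q_def \<gamma>_def[symmetric] deg top_coeff_def)
    \<comment> \<open>A zero would give \<open>t0 + t1 = -n\<close>, the excluded half-integer with
      numerator \<open>2 * n\<close>.\<close>
    moreover have "\<gamma> \<noteq> 0"
      using t01[of "2 * n"] False by (auto simp: \<gamma> add_eq_0_iff2)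
    moreover have "lead_coeff f \<noteq> 0"
      using norm by auto
    ultimately have q: "degree q = 2 * n" "lead_coeff q \<noteq> 0"
      using degree_eq_if_top_coeff by (metis mult_eq_0_iff zero_neq_numeral)+
    have Yq: "Y t0 u0 t1 u1 q = smult \<gamma> q"
      by (simp add: q_def Y_add Y_smult YY smult_add_right power2_eq_square)
    have p: "nonsym_wilson t0 u0 t1 u1 (2 * n) = smult (1 / lead_coeff q) q"
      using q Yq by (intro nonsym_wilson_eqI[OF gen]) (simp_all add: Y_smult \<gamma>_def mult.commute)
    have "C_plus t1 u1 q = smult (t1 +
        1 / (2 * t1) * (2 * t0 * t1 + of_nat n * (of_nat n + 2 * (t0 + t1))) + \<gamma>) f"
      unfolding q_def C_plus_add C_plus_smult C_plus_Y_even[OF t1 T1] C_plus_even[OF t1 T1] eigen s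
      by (simp only: smult_smult smult_add_left[symmetric])
    also have "\<dots> = smult \<kappa> f"
      using t1 by (intro arg_cong[of _ _ "\<lambda>k. smult k f"]) (simp add: \<gamma> \<kappa>_def field_simps)
    finally have Cq: "C_plus t1 u1 q = smult \<kappa> f" .
    \<comment> \<open>The value at \<open>-a\<close> equals the factor in \<open>Cq\<close>, so the
      normalization of \<open>E\<close> cancels it exactly.\<close>
    have qa: "poly q (- a) = \<kappa>"
      using poly_C_plus_fixed[of t1 u1 q] Cq norm t1 a by (simp add: a_eq)
    have "2 * t1 + of_nat n \<noteq> 0"
    proof
      assume "2 * t1 + of_nat n = 0"
      then have "a + b = - of_nat n" by (simp add: a_eq b_eq eq_neg_iff_add_eq_0)
      with ab show False by simp
    qed
    moreover have "of_nat n + 2 * (t0 + t1) \<noteq> 0"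
    proof
      assume "of_nat n + 2 * (t0 + t1) = 0"
      then have "t0 + t1 = - (of_nat n / 2)" by (simp add: field_simps add_eq_0_iff)
      with t01[of n] False show False by simp
    qed
    ultimately have "\<kappa> \<noteq> 0"
      using t1 by (simp add: \<kappa>_def)
    then show ?thesis
      using q unfolding E_plus_def E_def p a_eq[symmetric] C_plus_smult poly_smult qa Cq
      by simp
  qed
qed

end

section \<open>Identification with the hypergeometric series\<close>

theorem theorem3p19:
  fixes t0 u0 t1 u1 a b c d x :: complex and n :: nat
  assumes "generic t0 u0 t1 u1"
    and "a = t1 + u1" and "b = t1 - u1"
    and "c = t0 + u0 + 1/2" and "d = t0 - u0 + 1/2"
  shows "poly (E_plus t0 u0 t1 u1 (2 * n)) x =
    hypergeo_4F3 (- of_nat n) (of_nat n + a + b + c + d - 1) (a + x) (a - x)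
      (a + b) (a + c) (a + d) 1"
proof -
  interpret wilson_parameters t0 u0 t1 u1 a b c d
    using assms by unfold_locales
  define s where "s = a + b + c + d - 1"
  define w where "w j = pochhammer (- of_nat n) j * pochhammer (of_nat n + s) j /
    (pochhammer (a + b) j * pochhammer (a + c) j * pochhammer (a + d) j * fact j)" for j
  define f where "f = (\<Sum>j\<le>n. smult (w j) (basis j))"
  have s: "s = 2 * (t0 + t1)"
    using assms by (simp add: s_def)
  have nonint: "z + of_nat j \<noteq> 0" if "z \<notin> \<int>" for z :: complex and j :: nat
  proof
    assume "z + of_nat j = 0"
    then have "z = - of_nat j" by (simp add: eq_neg_iff_add_eq_0)
    with that show False by simp
  qed
  have "a + b \<notin> \<int>" "a + c \<notin> \<int>" "a + d \<notin> \<int>"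
    using assms unfolding generic_def Let_def by simp_all
  note nz = nonint[OF this(1)] nonint[OF this(2)] nonint[OF this(3)]
  have poch_nz: "pochhammer (a + b) j \<noteq> 0" "pochhammer (a + c) j \<noteq> 0" "pochhammer (a + d) j \<noteq> 0" for j
    using nz by (auto simp: pochhammer_eq_0_iff add_eq_0_iff2)
  have rec: "w (Suc j) * (of_nat (Suc j) *
      ((a + b + of_nat j) * (a + c + of_nat j) * (a + d + of_nat j))) =
      w j * (of_nat j * (of_nat j + (a + b + c + d - 1)) - of_nat n * (of_nat n + (a + b + c + d - 1)))" for j
  proof -
    \<comment> \<open>The numerator factors the eigenvalue difference:
      \<open>(j - n) (n + s + j) = j (j + s) - n (n + s)\<close>.\<close>
    have "w (Suc j) = w j * ((of_nat j - of_nat n) * (of_nat n + s + of_nat j) /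
        (of_nat (Suc j) * ((a + b + of_nat j) * (a + c + of_nat j) * (a + d + of_nat j))))"
      by (simp add: w_def pochhammer_Suc fact_Suc mult_ac)
    then show ?thesis
      using nz[of j] unfolding s_def[symmetric]
      by (simp del: of_nat_Suc) (simp add: algebra_simps)
  qed
  \<comment> \<open>This makes the degree exactly \<open>2 * n\<close>. A vanishing factor of
    \<open>(n + s)_n\<close> would give \<open>t0 + t1 = -(n + k) / 2\<close> with
    \<open>k < n\<close>.\<close>
  have wn: "w n \<noteq> 0"
  proof -
    have "pochhammer (of_nat n + s) n \<noteq> 0"
    proof
      assume "pochhammer (of_nat n + s) n = 0"
      then obtain k where k: "k < n" "of_nat n + s = - of_nat k"
        by (auto simp: pochhammer_eq_0_iff)
      then have "t0 + t1 = - (of_nat (n + k) / 2)"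
        by (simp add: s field_simps add_eq_0_iff)
      moreover have "n + k \<ge> 1" using k by simp
      ultimately show False
        using assms(1) unfolding generic_def Let_def by blast
    qed
    moreover have "pochhammer (- of_nat n :: complex) n \<noteq> 0"
      by (simp add: pochhammer_of_nat_eq_0_iff)
    ultimately show ?thesis
      using poch_nz by (simp add: w_def)
  qed
  have "degree f = 2 * n"
  proof -
    have "top_coeff (2 * n) f (w n * (-1) ^ n)"
    proof -
      have "top_coeff (2 * m) (\<Sum>j\<le>m. smult (w j) (basis j)) (w m * (-1) ^ m)" for m
      proof (induction m)
        case 0
        show ?case by (simp add: top_coeff_def poch_prod_0)
      next
        case (Suc m)
        then have "top_coeff (2 * Suc m) (\<Sum>j\<le>m. smult (w j) (basis j)) 0"
          by (auto simp: top_coeff_def coeff_eq_0)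
        from top_coeff_add[OF this top_coeff_smult[OF top_coeff_poch_prod[of "Suc m"], of "w (Suc m)"]]
        show ?case by simp
      qed
      then show ?thesis by (simp add: f_def)
    qed
    with wn show ?thesis
      using degree_eq_if_top_coeff by simp
  qed
  moreover have "T1 t1 u1 f = smult t1 f"
    by (rule T1_even) (simp add: f_def poly_sum poly_basis_minus)
  moreover have "wilson_op f = smult (2 * t0 * t1 + of_nat n * (of_nat n + (a + b + c + d - 1))) f"
    unfolding f_def by (rule wilson_op_eigenvector) (rule rec)
  moreover have "poly f (- a) = 1"
  proof -
    \<comment> \<open>At \<open>-a\<close> the factor \<open>(a + x)_j\<close> becomes
      \<open>(0)_j\<close>, which kills every term but the first.\<close>
    have "poly f (- a) = (\<Sum>j\<le>n. if j = 0 then 1 else 0)"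
      unfolding f_def poly_sum by (rule sum.cong) (auto simp: poly_poch_prod w_def pochhammer_0_left)
    then show ?thesis by simp
  qed
  ultimately have E: "E_plus t0 u0 t1 u1 (2 * n) = f"
    using E_plus_eqI assms(1) by blast
  have "hypergeo_4F3 (- of_nat n) (of_nat n + a + b + c + d - 1) (a + x) (a - x)
      (a + b) (a + c) (a + d) 1 = (\<Sum>j. w j * poly (basis j) x)"
    unfolding hypergeo_4F3_def
    by (rule suminf_cong) (simp add: w_def s_def poly_poch_prod add.assoc[symmetric] add_diff_eq)
  \<comment> \<open>The series terminates because \<open>(-n)_j = 0\<close> for
    \<open>j > n\<close>.\<close>
  also have "\<dots> = (\<Sum>j\<le>n. w j * poly (basis j) x)"
    by (rule suminf_finite) (auto simp: w_def pochhammer_of_nat_eq_0_iff)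
  also have "\<dots> = poly f x"
    by (simp add: f_def poly_sum)
  finally show ?thesis
    by (simp add: E)
qed

end
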